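(* The graph $K_6-e$ (the complete graph on $6$ vertices with one edge removed) is not an induced subgraph of $\mathcal{B}_k(G)$ for any finite simple graph $G$ and any positive integer $k$. Hence, for every $n\ge 6$, the graph $K_n-e$ is not an induced subgraph of any Bell coloring graph.
   Context: All graphs are finite and simple. A stable $k$-partition of a graph $G$ is a multiset $P=\{V_1,\dots,V_k\}$ of $k$ independent sets of $G$ (some possibly empty) that partition $V(G)$. For $v\in V(G)$, $P-v$ denotes the multiset $\{V_i\setminus\{v\}:1\le i\le k\}$. The Bell $k$-coloring graph $\mathcal{B}_k(G)$ has as vertices all stable $k$-partitions of $G$, and two distinct partitions $P,Q$ are adjacent if and only if $P-v=Q-v$ for some $v\in V(G)$. A Bell coloring graph is any graph of the form $\mathcal{B}_k(G)$. *)

theory Defs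
  imports
    "HOL-Library.Multiset"
    "Graph_Theory.Graph_Theory"
begin

text \<open>
  A finite simple graph is a \<^locale>\<open>pair_graph\<close>: an irreflexive, symmetric arc relation on a
  finite vertex set, each edge being represented by its two opposite arcs.
\<close>

definition independent_set :: "'a pair_pre_digraph \<Rightarrow> 'a set \<Rightarrow> bool" where
  "independent_set G S \<longleftrightarrow>
    S \<subseteq> pverts G \<and> (\<forall>u\<in>S. \<forall>v\<in>S. (u, v) \<notin> parcs G)"

text \<open>
  Disjointness is required between positions of the enumeration \<open>Vs\<close>, not between
  distinct members, so only the empty set can have multiplicity greater than one.
\<close>

definition stable_partitions :: "nat \<Rightarrow> 'a pair_pre_digraph \<Rightarrow> 'a set multiset set" where
  "stable_partitions k G =
    {P. \<exists>Vs. P = mset Vs \<and> length Vs = k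
      \<and> (\<forall>i<k. independent_set G (Vs ! i))
      \<and> (\<forall>i<k. \<forall>j<k. i \<noteq> j \<longrightarrow> Vs ! i \<inter> Vs ! j = {})
      \<and> (\<Union>i<k. Vs ! i) = pverts G}"

definition partition_del :: "'a set multiset \<Rightarrow> 'a \<Rightarrow> 'a set multiset" where
  "partition_del P v = image_mset (\<lambda>S. S - {v}) P"

definition bell_graph :: "nat \<Rightarrow> 'a pair_pre_digraph \<Rightarrow> 'a set multiset pair_pre_digraph" where
  "bell_graph k G =
    \<lparr> pverts = stable_partitions k G,
      parcs = {(P, Q). P \<in> stable_partitions k G \<and> Q \<in> stable_partitions k G \<and> P \<noteq> Q
        \<and> (\<exists>v \<in> pverts G. partition_del P v = partition_del Q v)} \<rparr>"

definition bell_coloring_graph :: "'a set multiset pair_pre_digraph \<Rightarrow> bool" where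
  "bell_coloring_graph B \<longleftrightarrow> (\<exists>G k. pair_graph G \<and> 1 \<le> k \<and> B = bell_graph k G)"

definition complete_graph :: "nat \<Rightarrow> nat pair_pre_digraph" where
  "complete_graph n = \<lparr> pverts = {..<n}, parcs = {(i, j). i < n \<and> j < n \<and> i \<noteq> j} \<rparr>"

definition delete_edge :: "'a pair_pre_digraph \<Rightarrow> 'a \<Rightarrow> 'a \<Rightarrow> 'a pair_pre_digraph" where
  "delete_edge G u v = \<lparr> pverts = pverts G, parcs = parcs G - {(u, v), (v, u)} \<rparr>"

text \<open>All choices of the deleted edge give isomorphic graphs; meaningful for \<open>n \<ge> 2\<close>.\<close>

definition complete_minus_edge :: "nat \<Rightarrow> nat pair_pre_digraph" where
  "complete_minus_edge n = delete_edge (complete_graph n) 0 1"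

text \<open>``Is an induced subgraph of'' up to isomorphism, as usual in graph theory.\<close>

definition is_induced_subgraph_of :: "'a pair_pre_digraph \<Rightarrow> 'b pair_pre_digraph \<Rightarrow> bool" where
  "is_induced_subgraph_of H G \<longleftrightarrow>
    (\<exists>H'. induced_subgraph H' (with_proj G) \<and> digraph_iso (with_proj H) H')"

lemma complete_graph_complete: "complete_digraph n (with_proj (complete_graph n))"
  unfolding complete_digraph_pair_def by (simp add: complete_graph_def)

lemma pair_graph_complete_minus_edge: "pair_graph (complete_minus_edge n)"
proof -
  have "finite {(i, j). i < n \<and> j < n \<and> i \<noteq> j}"
    by (rule finite_subset[of _ "{..<n} \<times> {..<n}"]) auto
  then show ?thesis
    by unfold_locales
      (auto simp: complete_minus_edge_def delete_edge_def complete_graph_def symmetric_def sym_def)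
qed

lemma finite_stable_partitions:
  assumes "finite (pverts G)"
  shows "finite (stable_partitions k G)"
proof (rule finite_subset)
  show "stable_partitions k G \<subseteq> mset ` {Vs. set Vs \<subseteq> Pow (pverts G) \<and> length Vs = k}"
  proof
    fix P assume "P \<in> stable_partitions k G"
    then obtain Vs where Vs: "P = mset Vs" "length Vs = k" "\<forall>i<k. independent_set G (Vs ! i)"
      unfolding stable_partitions_def by blast
    then have "set Vs \<subseteq> Pow (pverts G)"
      by (auto simp: independent_set_def set_conv_nth)
    with Vs show "P \<in> mset ` {Vs. set Vs \<subseteq> Pow (pverts G) \<and> length Vs = k}"
      by blast
  qed
  show "finite (mset ` {Vs. set Vs \<subseteq> Pow (pverts G) \<and> length Vs = k})"
    using assms by (intro finite_imageI finite_lists_length_eq) simp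
qed

lemma pair_graph_bell_graph:
  assumes "pair_graph G"
  shows "pair_graph (bell_graph k G)"
proof -
  interpret G: pair_graph G by fact
  have fin: "finite (stable_partitions k G)"
    by (rule finite_stable_partitions) (rule G.pair_finite_verts)
  have sub: "parcs (bell_graph k G) \<subseteq> stable_partitions k G \<times> stable_partitions k G"
    by (auto simp: bell_graph_def)
  have "finite (parcs (bell_graph k G))"
    by (rule finite_subset[OF sub]) (simp add: fin)
  moreover have "sym (parcs (bell_graph k G))"
    unfolding sym_def bell_graph_def by (simp, metis)
  moreover have "fst e \<noteq> snd e" if "e \<in> parcs (bell_graph k G)" for e
    using that by (auto simp: bell_graph_def)
  moreover have "pverts (bell_graph k G) = stable_partitions k G"
    by (simp add: bell_graph_def)
  ultimately show ?thesis
    using fin sub by unfold_locales (auto simp: symmetric_def)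
qed

end

theory Submission
  imports Defs
begin

text \<open>
  A stable \<open>k\<close>-partition is determined by its equivalence relation, and two partitions are adjacent
  iff their relations differ but agree off some vertex \<open>v\<close> (a label of the edge). If a triangle
  has no label common to its edges, its members differ only within three vertices, on which
  they each restrict to one of the five equivalence relations on three points. Any further common neighbour
  is also of this kind, and among the five relations the discrete and the total one are not
  adjacent, so such a triangle lies in no 5-clique. Hence all edges of a 5-clique share a label.
  In \<open>K\<^sub>6 - e\<close> the two 5-cliques meet in four vertices, and three pairwise adjacent partitions have
  at most one common label; so the labels of both cliques coincide and the ends of \<open>e\<close> would be adjacent.
\<close>

section \<open>Equivalence relations that agree off a point\<close>

text \<open>Expresses that \<open>v\<close> is a label of the pair \<open>r\<close>,
  \<open>s\<close>. Equal relations agree off every point, so distinctness is always assumed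
  separately.\<close>

definition agree_off :: "'a \<Rightarrow> ('a \<Rightarrow> 'a \<Rightarrow> bool) \<Rightarrow> ('a \<Rightarrow> 'a \<Rightarrow> bool) \<Rightarrow> bool" where
  "agree_off v r s \<longleftrightarrow> (\<forall>x y. x \<noteq> v \<longrightarrow> y \<noteq> v \<longrightarrow> r x y = s x y)"

lemma agree_offD: "agree_off v r s \<Longrightarrow> x \<noteq> v \<Longrightarrow> y \<noteq> v \<Longrightarrow> r x y = s x y"
  unfolding agree_off_def by blast

lemma agree_off_sym: "agree_off v r s \<Longrightarrow> agree_off v s r"
  unfolding agree_off_def by blast

lemma agree_off_trans: "agree_off v r s \<Longrightarrow> agree_off v s t \<Longrightarrow> agree_off v r t"
  unfolding agree_off_def by blast

text \<open>A pair on which the relations differ must contain \<open>u\<close> and must contain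
  \<open>w\<close>. By reflexivity and symmetry the only place left for a difference is
  \<open>{u, w}\<close>, and a difference exists.\<close>

lemma agree_off_two_labels:
  assumes "equivp r" "equivp s" "agree_off u r s" "agree_off w r s" "u \<noteq> w" "r \<noteq> s"
  shows "r u w \<noteq> s u w"
    and "x \<noteq> u \<or> y \<noteq> w \<Longrightarrow> x \<noteq> w \<or> y \<noteq> u \<Longrightarrow> r x y = s x y"
proof -
  show *: "r x y = s x y" if "x \<noteq> u \<or> y \<noteq> w" "x \<noteq> w \<or> y \<noteq> u" for x y
  proof (cases "x = y")
    case True
    then show ?thesis using assms(1,2) by (simp add: equivp_reflp)
  next
    case False
    then show ?thesis using that assms(5) agree_offD[OF assms(3), of x y]
      agree_offD[OF assms(4), of x y] by auto
  qed
  show "r u w \<noteq> s u w"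
  proof
    assume "r u w = s u w"
    moreover from this have "r w u = s w u" using assms(1,2) by (meson equivp_symp)
    ultimately have "r x y = s x y" for x y using *[of x y] by auto
    then have "r = s" by (intro ext)
    with assms(6) show False by blast
  qed
qed

text \<open>With two common labels, all three pairs of relations would differ at
  \<open>(u, w)\<close>, but three truth values cannot be pairwise distinct.\<close>

lemma agree_off_label_unique:
  assumes "equivp p" "equivp q" "equivp r" "p \<noteq> q" "q \<noteq> r" "p \<noteq> r"
    and "agree_off u p q" "agree_off u q r" "agree_off w p q" "agree_off w q r"
  shows "u = w"
proof (rule ccontr)
  assume "u \<noteq> w"
  moreover have "agree_off u p r" "agree_off w p r"
    using assms agree_off_trans[of _ p q r] by auto
  ultimately have "p u w \<noteq> q u w" "q u w \<noteq> r u w" "p u w \<noteq> r u w"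
    using agree_off_two_labels(1)[of p q u w] agree_off_two_labels(1)[of q r u w]
      agree_off_two_labels(1)[of p r u w] assms by auto
  then show False by blast
qed

text \<open>Agreement on the side opposite \<open>a\<close> leaves only pairs containing
  \<open>a\<close> for a difference. This produces new labels in the analysis of triangles.\<close>

lemma agree_offI_triangle:
  assumes "equivp r" "equivp s"
    and "\<And>y z. \<not> {y, z} \<subseteq> {a, b, c} \<Longrightarrow> r y z = s y z"
    and "r b c = s b c"
  shows "agree_off a r s"
  unfolding agree_off_def
proof (intro allI impI)
  fix y z
  assume ne: "y \<noteq> a" "z \<noteq> a"
  show "r y z = s y z"
  proof (cases "{y, z} \<subseteq> {a, b, c}")
    case True
    have "r y y = s y y" "r z z = s z z" "r y z = r z y" "s y z = s z y" for y z
      using assms(1,2) by (meson equivp_symp equivp_reflp)+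
    then show ?thesis using True ne assms(4) by auto
  next
    case False
    then show ?thesis using assms(3) by blast
  qed
qed

section \<open>Triangles without a common label\<close>

text \<open>Each edge differs on both pairs containing its own label: agreement on one of them would
  make the label of another edge a second label of this edge, hence by transitivity a label of the
  whole triangle.\<close>

lemma no_common_label_triangle:
  assumes eq: "equivp p" "equivp q" "equivp r"
    and pq: "agree_off u p q" and qr: "agree_off w q r" and pr: "agree_off x p r"
    and no: "\<nexists>v. agree_off v p q \<and> agree_off v q r"
  shows "u \<noteq> w" "u \<noteq> x" "w \<noteq> x"
    and "p u w \<noteq> q u w" "p u x \<noteq> q u x" "p w x = q w x"
    and "q u w \<noteq> r u w" "q u x = r u x" "q w x \<noteq> r w x"
    and "\<And>y z. \<not> {y, z} \<subseteq> {u, w, x} \<Longrightarrow> p y z = q y z \<and> q y z = r y z"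
proof -
  have no': "False" if "agree_off v p q \<and> agree_off v q r \<or> agree_off v p q \<and> agree_off v p r
      \<or> agree_off v q r \<and> agree_off v p r" for v
    using that no agree_off_trans[of v q p r] agree_off_trans[of v p r q]
      agree_off_sym[of v p q] agree_off_sym[of v q r] by blast
  show d: "u \<noteq> w" "u \<noteq> x" "w \<noteq> x" using no' pq qr pr by blast+
  note ag = agree_offD[OF pq] agree_offD[OF qr] agree_offD[OF pr]
  show out: "p y z = q y z \<and> q y z = r y z" if "\<not> {y, z} \<subseteq> {u, w, x}" for y z
  proof -
    \<comment> \<open>A pair not inside \<open>{u, w, x}\<close> contains at most one of the three
      labels, so two edges force equality there and the third follows.\<close>
    have "u \<notin> {y, z} \<and> w \<notin> {y, z} \<or> u \<notin> {y, z} \<and> x \<notin> {y, z} \<or> w \<notin> {y, z} \<and> x \<notin> {y, z}"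
      using that d by auto
    then show ?thesis using ag[of y z] by auto
  qed
  show "p w x = q w x" "q u x = r u x" using ag(1)[of w x] ag(2)[of u x] d by auto
  have puw: "p u w = r u w" using ag(3)[of u w] d by auto
  have out_pq: "p y z = q y z" and out_qr: "q y z = r y z" if "\<not> {y, z} \<subseteq> {u, w, x}" for y z
    using out[OF that] by simp_all
  show "p u w \<noteq> q u w"
  proof
    assume "p u w = q u w"
    then have "agree_off x p q"
      by (rule agree_offI_triangle[OF eq(1,2), rotated]) (rule out_pq, auto)
    then show False using no' pr by blast
  qed
  then show "q u w \<noteq> r u w" using puw by blast
  show "p u x \<noteq> q u x"
  proof
    assume "p u x = q u x"
    then have "agree_off w p q"
      by (rule agree_offI_triangle[OF eq(1,2), rotated]) (rule out_pq, auto)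
    then show False using no' qr by blast
  qed
  show "q w x \<noteq> r w x"
  proof
    assume "q w x = r w x"
    then have "agree_off u q r"
      by (rule agree_offI_triangle[OF eq(2,3), rotated]) (rule out_qr, auto)
    then show False using no' pq by blast
  qed
qed

text \<open>Suppose \<open>s\<close> differs from \<open>p\<close> at \<open>(y, z)\<close>, where
  \<open>p\<close>, \<open>q\<close>, \<open>r\<close> coincide. Then \<open>a\<close>,
  \<open>b\<close>, \<open>c\<close> all lie in \<open>{y, z}\<close>, so \<open>p\<close>,
  \<open>q\<close>, \<open>r\<close> agree with \<open>s\<close>, and thus with each other, on all
  pairs avoiding \<open>y\<close> and \<open>z\<close>. Two of \<open>u\<close>, \<open>w\<close>,
  \<open>x\<close> form such a pair, yet \<open>p\<close>, \<open>q\<close>, \<open>r\<close> do not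
  coincide on any pair of these labels.\<close>

lemma extend_no_common_label_triangle:
  assumes eq: "equivp p" "equivp q" "equivp r"
    and pq: "agree_off u p q" and qr: "agree_off w q r" and pr: "agree_off x p r"
    and no: "\<nexists>v. agree_off v p q \<and> agree_off v q r"
    and s: "agree_off a s p" "agree_off b s q" "agree_off c s r"
    and yz: "\<not> {y, z} \<subseteq> {u, w, x}"
  shows "s y z = p y z"
proof (rule ccontr)
  note tri = no_common_label_triangle[OF eq pq qr pr no]
  assume ne: "s y z \<noteq> p y z"
  have "s y z \<noteq> q y z" "s y z \<noteq> r y z" using ne tri(10)[OF yz] by blast+
  then have in_yz: "a \<in> {y, z}" "b \<in> {y, z}" "c \<in> {y, z}"
    using ne agree_offD[OF s(1), of y z] agree_offD[OF s(2), of y z] agree_offD[OF s(3), of y z]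
    by auto
  have const: "p i j = q i j \<and> q i j = r i j" if "i \<notin> {y, z}" "j \<notin> {y, z}" for i j
    using that in_yz agree_offD[OF s(1), of i j] agree_offD[OF s(2), of i j]
      agree_offD[OF s(3), of i j] by blast
  have "(u \<notin> {y, z} \<and> w \<notin> {y, z}) \<or> (u \<notin> {y, z} \<and> x \<notin> {y, z}) \<or> (w \<notin> {y, z} \<and> x \<notin> {y, z})"
    using yz tri(1-3) by auto
  then show False using const tri(4-9) by blast
qed

lemma five_clique_triangle_common_label:
  assumes eq: "equivp p" "equivp q" "equivp r" "equivp s" "equivp t"
    and dist: "distinct [p, q, r, s, t]"
    and adj: "\<And>i j. {i, j} \<subseteq> {p, q, r, s, t} \<Longrightarrow> \<exists>v. agree_off v i j"
  shows "\<exists>v. agree_off v p q \<and> agree_off v q r"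
proof (rule ccontr)
  assume no: "\<nexists>v. agree_off v p q \<and> agree_off v q r"
  obtain u w x where pq: "agree_off u p q" and qr: "agree_off w q r" and pr: "agree_off x p r"
    using adj[of p q] adj[of q r] adj[of p r] by auto
  note tri = no_common_label_triangle[OF eq(1-3) pq qr pr no]
  let ?K = "{p, q, r, s, t}"
  have out: "i y z = p y z" if "i \<in> ?K" "\<not> {y, z} \<subseteq> {u, w, x}" for i y z
  proof -
    obtain a b c where "agree_off a i p" "agree_off b i q" "agree_off c i r"
      using adj[of i p] adj[of i q] adj[of i r] \<open>i \<in> ?K\<close> by auto
    then show ?thesis
      using extend_no_common_label_triangle[OF eq(1-3) pq qr pr no] that(2) by blast
  qed
  have eqK: "equivp i" if "i \<in> ?K" for i using that eq by blast
  \<comment> \<open>Transitivity excludes exactly two related pairs among three points, leaving five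
    of the eight patterns.\<close>
  have pat: "\<not> (i u w \<and> i u x \<and> \<not> i w x)" "\<not> (i u w \<and> \<not> i u x \<and> i w x)"
    "\<not> (\<not> i u w \<and> i u x \<and> i w x)" if "i \<in> ?K" for i
    using eqK[OF that] by (meson equivp_symp equivp_transp)+
  have ne: "i u w \<noteq> j u w \<or> i u x \<noteq> j u x \<or> i w x \<noteq> j w x"
    if ij: "i \<in> ?K" "j \<in> ?K" "i \<noteq> j" for i j
  proof (rule ccontr)
    assume c: "\<not> ?thesis"
    have "i y z = j y z" for y z
    proof (cases "{y, z} \<subseteq> {u, w, x}")
      case True
      have "i y y = j y y" "i z z = j z z" "i y z = i z y" "j y z = j z y" for y z
        using eqK ij by (meson equivp_symp equivp_reflp)+
      then show ?thesis using True c by auto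
    next
      case False
      then show ?thesis using out[OF ij(1)] out[OF ij(2)] by simp
    qed
    then have "i = j" by (intro ext)
    with ij(3) show False by contradiction
  qed
  \<comment> \<open>At least one of the three pairs avoids the label \<open>v\<close>; this is what
    keeps the discrete and the total pattern apart.\<close>
  have star: "i u w = j u w \<or> i u x = j u x \<or> i w x = j w x" if ij: "i \<in> ?K" "j \<in> ?K" for i j
  proof -
    obtain v where v: "agree_off v i j" using adj[of i j] ij by auto
    show ?thesis
      using agree_offD[OF v, of u w] agree_offD[OF v, of u x] agree_offD[OF v, of w x] tri(1-3)
      by blast
  qed
  have K: "p \<in> ?K" "q \<in> ?K" "r \<in> ?K" "s \<in> ?K" "t \<in> ?K" by auto
  have d: "s \<noteq> p" "s \<noteq> q" "s \<noteq> r" "t \<noteq> p" "t \<noteq> q" "t \<noteq> r" "s \<noteq> t" using dist by auto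
  \<comment> \<open>Five members with distinct patterns use up all five patterns, including the
    discrete and the total one, which violate \<open>star\<close>.\<close>
  show False
    using tri(4-9) pat[OF K(1)] pat[OF K(2)] pat[OF K(3)] pat[OF K(4)] pat[OF K(5)]
      ne[OF K(4) K(1) d(1)] ne[OF K(4) K(2) d(2)] ne[OF K(4) K(3) d(3)]
      ne[OF K(5) K(1) d(4)] ne[OF K(5) K(2) d(5)] ne[OF K(5) K(3) d(6)] ne[OF K(4) K(5) d(7)]
      star[OF K(4) K(1)] star[OF K(4) K(2)] star[OF K(4) K(3)]
      star[OF K(5) K(1)] star[OF K(5) K(2)] star[OF K(5) K(3)] star[OF K(4) K(5)]
    by argo
qed

section \<open>Labels of cliques\<close>

text \<open>If \<open>v\<close> fails for \<open>s\<close>, then \<open>a\<close>, \<open>b\<close>,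
  \<open>c\<close> differ from \<open>v\<close>, so each edge of the triangle has two labels and
  differs only at \<open>{v, a}\<close>, \<open>{v, b}\<close> or \<open>{v, c}\<close>
  respectively. Since \<open>a\<close> and \<open>b\<close> are distinct, \<open>p\<close> and
  \<open>r\<close> differ at both \<open>{v, a}\<close> and \<open>{v, b}\<close>, which is one pair
  too many.\<close>

lemma extend_common_label:
  assumes eq: "equivp p" "equivp q" "equivp r" and d: "p \<noteq> q" "q \<noteq> r" "p \<noteq> r"
    and v: "agree_off v p q" "agree_off v q r"
    and a: "agree_off a p q" "agree_off a q s"
    and b: "agree_off b q r" "agree_off b r s"
    and c: "agree_off c p r" "agree_off c r s"
  shows "agree_off v p s"
proof (rule ccontr)
  assume no: "\<not> agree_off v p s"
  have vpr: "agree_off v p r" by (rule agree_off_trans[OF v])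
  have ne: "v \<noteq> a" "v \<noteq> b" "v \<noteq> c"
    using no agree_off_trans[OF v(1), of s] agree_off_trans[OF vpr, of s] a b c by auto
  note pq = agree_off_two_labels[OF eq(1,2) v(1) a(1) ne(1) d(1)]
    and qr = agree_off_two_labels[OF eq(2,3) v(2) b(1) ne(2) d(2)]
    and pr = agree_off_two_labels[OF eq(1,3) vpr c(1) ne(3) d(3)]
  have "a \<noteq> b" using agree_off_label_unique[OF eq d v a(1)] b(1) ne(1) by blast
  then have "p v a \<noteq> r v a" "p v b \<noteq> r v b"
    using pq(1) pq(2)[of v b] qr(1) qr(2)[of v a] ne by auto
  then have "a = c" "b = c" using pr(2)[of v a] pr(2)[of v b] ne by blast+
  with \<open>a \<noteq> b\<close> show False by blast
qed

lemma five_clique_common_label: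
  assumes eq: "\<And>r. r \<in> K \<Longrightarrow> equivp r" and card: "5 \<le> card K"
    and adj: "\<And>r s. r \<in> K \<Longrightarrow> s \<in> K \<Longrightarrow> \<exists>v. agree_off v r s"
  shows "\<exists>v. \<forall>r\<in>K. \<forall>s\<in>K. agree_off v r s"
proof -
  \<comment> \<open>Any three members are completed to a 5-clique by two further members of
    \<open>K\<close>.\<close>
  have tri: "\<exists>v. agree_off v p q \<and> agree_off v q r"
    if K: "p \<in> K" "q \<in> K" "r \<in> K" and d: "p \<noteq> q" "q \<noteq> r" "p \<noteq> r" for p q r
  proof -
    have "card (K - {p, q, r}) = card K - 3"
      using K d card by (subst card_Diff_subset) auto
    then have "2 \<le> card (K - {p, q, r})" using card by linarith
    then obtain L where "L \<subseteq> K - {p, q, r}" "card L = 2"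
      by (metis obtain_subset_with_card_n)
    then obtain s t where st: "s \<in> K - {p, q, r}" "t \<in> K - {p, q, r}" "s \<noteq> t"
      by (auto simp: card_2_iff)
    show ?thesis
    proof (rule five_clique_triangle_common_label)
      show "distinct [p, q, r, s, t]" using st d by auto
      show "\<exists>v. agree_off v i j" if "{i, j} \<subseteq> {p, q, r, s, t}" for i j
        using that st K by (intro adj) auto
    qed (use eq K st in auto)
  qed
  have "3 \<le> card K" using card by linarith
  then obtain L where "L \<subseteq> K" "card L = 3"
    by (metis obtain_subset_with_card_n)
  then obtain p q r where K: "p \<in> K" "q \<in> K" "r \<in> K" and d: "p \<noteq> q" "q \<noteq> r" "p \<noteq> r"
    by (auto simp: card_3_iff)
  obtain v where v: "agree_off v p q" "agree_off v q r" using tri[OF K d] by blast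
  have "agree_off v p s" if s: "s \<in> K" for s
  proof (cases "s \<in> {p, q, r}")
    case True
    moreover have "agree_off v p p" by (simp add: agree_off_def)
    ultimately show ?thesis using v agree_off_trans[OF v] by auto
  next
    case False
    obtain a b c where "agree_off a p q" "agree_off a q s" "agree_off b q r" "agree_off b r s"
      "agree_off c p r" "agree_off c r s"
      using tri[of p q s] tri[of q r s] tri[of p r s] K d s False by auto
    then show ?thesis
      by (rule extend_common_label[OF eq[OF K(1)] eq[OF K(2)] eq[OF K(3)] d v])
  qed
  then have "\<forall>r\<in>K. \<forall>s\<in>K. agree_off v r s" using agree_off_sym agree_off_trans by metis
  then show ?thesis by blast
qed

text \<open>Here \<open>p\<close> and \<open>q\<close> play the ends of the missing edge and
  \<open>S\<close> the vertices shared by the two cliques. The labels \<open>u\<close> and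
  \<open>w\<close> of the cliques coincide on a triangle in \<open>S\<close>, and any member of
  \<open>S\<close> then links \<open>p\<close> to \<open>q\<close> by transitivity.\<close>

lemma four_common_neighbours_agree_off:
  assumes eq: "equivp p" "equivp q" "\<And>r. r \<in> S \<Longrightarrow> equivp r"
    and card: "4 \<le> card S" and notin: "p \<notin> S" "q \<notin> S"
    and adj: "\<And>r s. r \<in> S \<Longrightarrow> s \<in> S \<Longrightarrow> \<exists>v. agree_off v r s"
      "\<And>r. r \<in> S \<Longrightarrow> \<exists>v. agree_off v p r" "\<And>r. r \<in> S \<Longrightarrow> \<exists>v. agree_off v q r"
  shows "\<exists>v. agree_off v p q"
proof -
  have fin: "finite S" using card by (metis card.infinite not_numeral_le_zero)
  have common: "\<exists>v. \<forall>r\<in>insert x S. \<forall>s\<in>insert x S. agree_off v r s"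
    if "equivp x" "x \<notin> S" and adj_x: "\<And>r. r \<in> S \<Longrightarrow> \<exists>v. agree_off v x r" for x
  proof (rule five_clique_common_label)
    show "5 \<le> card (insert x S)" using fin that(2) card by simp
    have refl: "\<exists>v. agree_off v x x" by (simp add: agree_off_def)
    have sym: "\<exists>v. agree_off v r x" if "r \<in> S" for r
      using adj_x[OF that] agree_off_sym[of _ x r] by metis
    show "\<exists>v. agree_off v r s" if "r \<in> insert x S" "s \<in> insert x S" for r s
      using that adj(1)[of r s] adj_x[of s] sym[of r] refl by auto
  qed (use eq that in auto)
  obtain u w where u: "\<forall>r\<in>insert p S. \<forall>s\<in>insert p S. agree_off u r s"
    and w: "\<forall>r\<in>insert q S. \<forall>s\<in>insert q S. agree_off w r s"
    using common[OF eq(1) notin(1) adj(2)] common[OF eq(2) notin(2) adj(3)] by metis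
  have "3 \<le> card S" using card by linarith
  then obtain L where "L \<subseteq> S" "card L = 3"
    by (metis obtain_subset_with_card_n)
  then obtain x y z where S: "x \<in> S" "y \<in> S" "z \<in> S" and d: "x \<noteq> y" "y \<noteq> z" "x \<noteq> z"
    by (auto simp: card_3_iff)
  have "u = w"
    using agree_off_label_unique[OF eq(3)[OF S(1)] eq(3)[OF S(2)] eq(3)[OF S(3)] d, of u w] u w S
    by simp
  then have "agree_off u p x" "agree_off u x q" using u w S by simp_all
  then show ?thesis using agree_off_trans[of u p x q] by blast
qed

section \<open>Partitions as equivalence relations\<close>

text \<open>The disjunct \<open>x = y\<close> makes points outside all blocks singleton classes, so
  this is an equivalence relation on the whole type. Empty blocks leave no trace in it.\<close>

definition block_rel :: "'a set multiset \<Rightarrow> 'a \<Rightarrow> 'a \<Rightarrow> bool" where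
  "block_rel M x y \<longleftrightarrow> x = y \<or> (\<exists>S\<in>#M. x \<in> S \<and> y \<in> S)"

text \<open>Counting blocks with multiplicity expresses covering and disjointness by position at
  once: a nonempty block cannot be repeated, while the empty block may have any
  multiplicity.\<close>

definition partitions_mset :: "'a set multiset \<Rightarrow> 'a set \<Rightarrow> bool" where
  "partitions_mset M U \<longleftrightarrow> (\<forall>x. size {#S \<in># M. x \<in> S#} = (if x \<in> U then 1 else 0))"

lemma partitions_msetD:
  assumes "partitions_mset M U" "S \<in># M" "T \<in># M" "x \<in> S" "x \<in> T"
  shows "x \<in> U" "S = T"
proof -
  have S: "S \<in># {#S \<in># M. x \<in> S#}" and T: "T \<in># {#S \<in># M. x \<in> S#}" using assms by auto
  then have "size {#S \<in># M. x \<in> S#} \<noteq> 0" by auto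
  then show "x \<in> U" using assms(1) unfolding partitions_mset_def by metis
  then have "size {#S \<in># M. x \<in> S#} = 1" using assms(1) unfolding partitions_mset_def by metis
  then obtain B where "{#S \<in># M. x \<in> S#} = {#B#}" using size_1_singleton_mset by blast
  then show "S = T" using S T by simp
qed

lemma filter_mset_block:
  assumes "partitions_mset M U" "x \<in> U"
  shows "{#S \<in># M. x \<in> S#} = {#{y. block_rel M x y}#}"
proof -
  have "size {#S \<in># M. x \<in> S#} = 1" using assms unfolding partitions_mset_def by metis
  then obtain B where B: "{#S \<in># M. x \<in> S#} = {#B#}" using size_1_singleton_mset by blast
  then have "B \<in># {#S \<in># M. x \<in> S#}" by simp
  then have "B \<in># M" "x \<in> B" by auto
  then have "{y. block_rel M x y} = B"
    using partitions_msetD(2)[OF assms(1)] unfolding block_rel_def by blast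
  with B show ?thesis by simp
qed

lemma equivp_block_rel:
  assumes "partitions_mset M U"
  shows "equivp (block_rel M)"
proof (intro equivpI reflpI sympI transpI)
  fix x y z
  assume "block_rel M x y" "block_rel M y z"
  then show "block_rel M x z"
    using partitions_msetD(2)[OF assms] unfolding block_rel_def by metis
qed (auto simp: block_rel_def)

text \<open>Equality of sizes is what pins down the multiplicity of the empty block.\<close>

lemma partitions_mset_eqI:
  assumes M: "partitions_mset M U" and N: "partitions_mset N U"
    and size: "size M = size N" and rel: "block_rel M = block_rel N"
  shows "M = N"
proof -
  have count: "count M S = count N S" if S: "S \<noteq> {}" for S
  proof -
    obtain x where x: "x \<in> S" using S by blast
    \<comment> \<open>The multiplicity of a nonempty block is read off among the blocks through one
      of its points, and these are determined by the relation.\<close>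
    have "{#T \<in># M. x \<in> T#} = {#T \<in># N. x \<in> T#}"
    proof (cases "x \<in> U")
      case True
      then show ?thesis using filter_mset_block[OF M] filter_mset_block[OF N] rel by simp
    next
      case False
      then have "size {#T \<in># M. x \<in> T#} = 0" "size {#T \<in># N. x \<in> T#} = 0"
        using M N unfolding partitions_mset_def by metis+
      then show ?thesis by (simp only: size_eq_0_iff_empty)
    qed
    then have "count {#T \<in># M. x \<in> T#} S = count {#T \<in># N. x \<in> T#} S" by simp
    with x show ?thesis by simp
  qed
  then have nonempty: "{#S \<in># M. S \<noteq> {}#} = {#S \<in># N. S \<noteq> {}#}"
    by (intro multiset_eqI) simp
  have split: "size L = size {#S \<in># L. S \<noteq> {}#} + count L {}" for L :: "'a set multiset"
  proof -
    have "L = {#S \<in># L. S \<noteq> {}#} + {#S \<in># L. S = {}#}"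
      using multiset_partition[of L "\<lambda>S. S \<noteq> {}"] by simp
    moreover have "size {#S \<in># L. S = {}#} = count L {}"
      by (simp add: filter_eq_replicate_mset)
    ultimately show ?thesis by (metis size_union)
  qed
  have "count M {} = count N {}" using split[of M] split[of N] size nonempty by simp
  with count show ?thesis by (metis multiset_eqI)
qed

lemma partitions_mset_partition_del:
  assumes "partitions_mset M U"
  shows "partitions_mset (partition_del M v) (U - {v})"
  unfolding partitions_mset_def
proof
  fix x
  have "{#S \<in># partition_del M v. x \<in> S#} =
      image_mset (\<lambda>S. S - {v}) {#S \<in># M. x \<in> S \<and> x \<noteq> v#}"
    unfolding partition_del_def filter_mset_image_mset by (simp add: o_def)
  then show "size {#S \<in># partition_del M v. x \<in> S#} = (if x \<in> U - {v} then 1 else 0)"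
    using assms unfolding partitions_mset_def by (cases "x = v") auto
qed

lemma block_rel_partition_del:
  "block_rel (partition_del M v) x y \<longleftrightarrow> x = y \<or> x \<noteq> v \<and> y \<noteq> v \<and> block_rel M x y"
  unfolding block_rel_def partition_del_def by auto

text \<open>Deleting \<open>v\<close> turns it into a singleton class and changes no other pair. The
  size is preserved because a block that becomes empty is kept, so
  \<open>partitions_mset_eqI\<close> recovers the multisets from the relations.\<close>

lemma partition_del_eq_iff_agree_off:
  assumes "partitions_mset M U" "partitions_mset N U" "size M = size N"
  shows "partition_del M v = partition_del N v \<longleftrightarrow> agree_off v (block_rel M) (block_rel N)"
proof
  assume "partition_del M v = partition_del N v"
  then show "agree_off v (block_rel M) (block_rel N)"
    unfolding agree_off_def using block_rel_partition_del[of _ v] by (metis block_rel_def)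
next
  assume "agree_off v (block_rel M) (block_rel N)"
  then have "block_rel (partition_del M v) = block_rel (partition_del N v)"
    by (intro ext) (auto simp: block_rel_partition_del agree_off_def)
  then show "partition_del M v = partition_del N v"
    using assms partitions_mset_eqI partitions_mset_partition_del
    by (metis partition_del_def size_image_mset)
qed

lemma stable_partitions_partitions_mset:
  assumes "P \<in> stable_partitions k G"
  shows "partitions_mset P (pverts G)" "size P = k"
proof -
  obtain Vs where Vs: "P = mset Vs" "length Vs = k"
    "\<forall>i<k. \<forall>j<k. i \<noteq> j \<longrightarrow> Vs ! i \<inter> Vs ! j = {}" "(\<Union>i<k. Vs ! i) = pverts G"
    using assms unfolding stable_partitions_def by blast
  show "size P = k" using Vs by simp
  have "size {#S \<in># P. x \<in> S#} = (if x \<in> pverts G then 1 else 0)" for x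
  proof -
    \<comment> \<open>Blocks are counted by their positions in the enumeration, since disjointness
      is stated between positions.\<close>
    have "size {#S \<in># P. x \<in> S#} = length (filter (\<lambda>S. x \<in> S) Vs)"
      unfolding Vs(1) by (metis mset_filter size_mset)
    also have "\<dots> = card {i. i < k \<and> x \<in> Vs ! i}"
      using Vs(2) by (simp add: length_filter_conv_card)
    also have "\<dots> = (if x \<in> pverts G then 1 else 0)"
    proof (cases "x \<in> pverts G")
      case True
      then obtain i where "i < k" "x \<in> Vs ! i" using Vs(4) by blast
      then have "{i. i < k \<and> x \<in> Vs ! i} = {i}" using Vs(3) by blast
      then show ?thesis using True by simp
    next
      case False
      then have "{i. i < k \<and> x \<in> Vs ! i} = {}" using Vs(4) by blast
      then show ?thesis using False by simp
    qed
    finally show ?thesis .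
  qed
  then show "partitions_mset P (pverts G)" unfolding partitions_mset_def by blast
qed

lemma inj_on_block_rel: "inj_on block_rel (stable_partitions k G)"
  by (intro inj_onI) (metis partitions_mset_eqI stable_partitions_partitions_mset)

text \<open>The label may range over the whole type: a point outside the graph is isolated in both
  relations, so agreement off it would make them equal, and then \<open>P = Q\<close> by
  injectivity.\<close>

lemma bell_graph_arc_iff:
  assumes P: "P \<in> stable_partitions k G" and Q: "Q \<in> stable_partitions k G"
  shows "(P, Q) \<in> parcs (bell_graph k G) \<longleftrightarrow>
    P \<noteq> Q \<and> (\<exists>v. agree_off v (block_rel P) (block_rel Q))"
proof -
  note part = stable_partitions_partitions_mset(1)[OF P] stable_partitions_partitions_mset(1)[OF Q]
  have size: "size P = size Q" using P Q stable_partitions_partitions_mset(2) by metis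
  have "v \<in> pverts G" if "P \<noteq> Q" "agree_off v (block_rel P) (block_rel Q)" for v
  proof (rule ccontr)
    assume "v \<notin> pverts G"
    then have "block_rel P x y = (x = y)" "block_rel Q x y = (x = y)" if "x = v \<or> y = v" for x y
      using that partitions_msetD(1)[OF part(1)] partitions_msetD(1)[OF part(2)]
      unfolding block_rel_def by blast+
    then have "block_rel P x y = block_rel Q x y" for x y
      using agree_offD[OF that(2), of x y] by blast
    then have "block_rel P = block_rel Q" by (intro ext)
    then show False using that(1) P Q inj_on_block_rel by (metis inj_onD)
  qed
  then show ?thesis
    using P Q partition_del_eq_iff_agree_off[OF part size] by (auto simp: bell_graph_def)
qed

section \<open>Induced copies of the complete graph minus an edge\<close>

lemma is_induced_subgraph_ofE:
  assumes "is_induced_subgraph_of H G"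
  obtains f where "inj_on f (pverts H)" "f ` pverts H \<subseteq> pverts G"
    "\<And>x y. x \<in> pverts H \<Longrightarrow> y \<in> pverts H \<Longrightarrow> (f x, f y) \<in> parcs G \<longleftrightarrow> (x, y) \<in> parcs H"
proof -
  obtain h where h: "pre_digraph.digraph_isomorphism (with_proj H) h"
    and ind: "induced_subgraph (app_iso h (with_proj H)) (with_proj G)"
    using assms unfolding is_induced_subgraph_of_def digraph_iso_def by blast
  let ?f = "iso_verts h"
  have inj: "inj_on ?f (pverts H)" and wf: "wf_digraph (with_proj H)"
    using h by (auto simp: pre_digraph.digraph_isomorphism_def)
  have sub: "?f ` pverts H \<subseteq> pverts G" and ht: "iso_head h = snd" "iso_tail h = fst"
    and arcs: "iso_arcs h ` parcs H = {e \<in> parcs G. fst e \<in> ?f ` pverts H \<and> snd e \<in> ?f ` pverts H}"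
    using ind by (auto simp: induced_subgraph_def subgraph_def compatible_def)
  \<comment> \<open>Compatibility with \<open>G\<close> forces the head and tail maps of the image
    to be the projections, so the arc map is determined by the vertex map.\<close>
  have iso: "iso_arcs h (x, y) = (?f x, ?f y)" if "(x, y) \<in> parcs H" for x y
    using h that ht by (auto simp: pre_digraph.digraph_isomorphism_def prod_eq_iff)
  have "(?f x, ?f y) \<in> parcs G \<longleftrightarrow> (x, y) \<in> parcs H"
    if xy: "x \<in> pverts H" "y \<in> pverts H" for x y
  proof
    assume "(?f x, ?f y) \<in> parcs G"
    then have "(?f x, ?f y) \<in> iso_arcs h ` parcs H" using arcs xy by auto
    then obtain x' y' where a: "(x', y') \<in> parcs H" "(?f x, ?f y) = (?f x', ?f y')"
      using iso by auto
    moreover have "x' \<in> pverts H" "y' \<in> pverts H"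
      using wf_digraph.wellformed[OF wf, of "(x', y')"] a(1) by auto
    ultimately show "(x, y) \<in> parcs H" using inj xy by (auto dest: inj_onD)
  next
    assume "(x, y) \<in> parcs H"
    then show "(?f x, ?f y) \<in> parcs G" using iso arcs
      by (metis (no_types, lifting) imageI mem_Collect_eq)
  qed
  with inj sub show thesis using that by blast
qed

lemma complete_minus_edge_not_induced:
  assumes "6 \<le> n"
  shows "\<not> is_induced_subgraph_of (complete_minus_edge n) (bell_graph k G)"
proof
  assume "is_induced_subgraph_of (complete_minus_edge n) (bell_graph k G)"
  then obtain f where inj: "inj_on f {..<n}" and sub: "f ` {..<n} \<subseteq> stable_partitions k G"
    and arc: "\<And>i j. i < n \<Longrightarrow> j < n \<Longrightarrow> (f i, f j) \<in> parcs (bell_graph k G) \<longleftrightarrow>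
      i \<noteq> j \<and> (i, j) \<noteq> (0, 1) \<and> (i, j) \<noteq> (1, 0)"
    by (rule is_induced_subgraph_ofE)
      (auto simp: complete_minus_edge_def delete_edge_def complete_graph_def bell_graph_def)
  define g where "g i = block_rel (f i)" for i
  have st: "f i \<in> stable_partitions k G" if "i < n" for i using sub that by blast
  have eq: "equivp (g i)" if "i < n" for i
    unfolding g_def using stable_partitions_partitions_mset(1)[OF st[OF that]] equivp_block_rel by blast
  have inj_g: "inj_on g {..<n}"
    using comp_inj_on[OF inj inj_on_subset[OF inj_on_block_rel sub]] by (simp add: g_def[abs_def] o_def)
  have arc_g: "(\<exists>v. agree_off v (g i) (g j)) \<longleftrightarrow> i \<noteq> j \<and> (i, j) \<noteq> (0, 1) \<and> (i, j) \<noteq> (1, 0)"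
    if "i < n" "j < n" "i \<noteq> j" for i j
    using arc[OF that(1,2)] bell_graph_arc_iff[OF st[OF that(1)] st[OF that(2)]] that inj
    unfolding g_def by (metis inj_onD lessThan_iff)
  have "\<exists>v. agree_off v (g 0) (g 1)"
  \<comment> \<open>Vertices 0 and 1 are the ends of the deleted edge. With 2 to 5 they already
    induce \<open>K_6 - e\<close>, which settles every \<open>n \<ge> 6\<close> at once.\<close>
  proof (rule four_common_neighbours_agree_off[where S = "g ` {2..<6}"])
    have "inj_on g {2..<6}" using inj_g by (rule inj_on_subset) (use assms in auto)
    then show "4 \<le> card (g ` {2..<6})" by (simp add: card_image)
    show "g 0 \<notin> g ` {2..<6}" "g 1 \<notin> g ` {2..<6}"
      using inj_g assms by (auto dest!: inj_onD)
    show "\<exists>v. agree_off v r s" if rs: "r \<in> g ` {2..<6}" "s \<in> g ` {2..<6}" for r s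
    proof -
      obtain i j where ij: "r = g i" "s = g j" "i \<in> {2..<6}" "j \<in> {2..<6}" using rs by blast
      show ?thesis
      proof (cases "i = j")
        case True
        then show ?thesis using ij by (simp add: agree_off_def)
      next
        case False
        then show ?thesis using arc_g[of i j] ij assms by auto
      qed
    qed
    show "\<exists>v. agree_off v (g 0) r" "\<exists>v. agree_off v (g 1) r" if r: "r \<in> g ` {2..<6}" for r
    proof -
      obtain i where "r = g i" "i \<in> {2..<6}" using r by blast
      then show "\<exists>v. agree_off v (g 0) r" "\<exists>v. agree_off v (g 1) r"
        using arc_g[of 0 i] arc_g[of 1 i] assms by auto
    qed
  qed (use eq assms in auto)
  then show False using arc_g[of 0 1] assms by simp
qed

theorem theorem3p10:
  shows "(\<forall>(G :: 'a pair_pre_digraph) k. pair_graph G \<longrightarrow> 1 \<le> k \<longrightarrow>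
            \<not> is_induced_subgraph_of (complete_minus_edge 6) (bell_graph k G))
       \<and> (\<forall>n\<ge>6. \<forall>B :: 'a set multiset pair_pre_digraph. bell_coloring_graph B \<longrightarrow>
            \<not> is_induced_subgraph_of (complete_minus_edge n) B)"
  using complete_minus_edge_not_induced unfolding bell_coloring_graph_def by blast

end
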